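(* For every $g\ge 1$ and $k\in\{2,3\}$, the $k$-power domination number of the Sierpiński graph $\mathcal{S}_g$ is $\gamma_{P,k}(\mathcal{S}_g)=1$.
   Context: Sierpiński graph: $\mathcal{S}_1$ is a triangle whose three vertices are its outmost vertices $A_1,B_1,C_1$. Given $\mathcal{S}_g$ with outmost vertices $A_g,B_g,C_g$, take three copies $\mathcal{S}_g^\theta$ ($\theta=1,2,3$) with outmost vertices $A_g^\theta,B_g^\theta,C_g^\theta$, identify $B_g^1$ with $A_g^2$, $C_g^2$ with $B_g^3$, and $C_g^1$ with $A_g^3$; the result is $\mathcal{S}_{g+1}$, with outmost vertices $A_{g+1}=A_g^1$, $B_{g+1}=B_g^2$, $C_{g+1}=C_g^3$ (these have degree 2; all other vertices have degree 4). For a graph $G$, nonnegative integer $k$ and $D\subseteq V(G)$: $P^0_{G,k}(D)=N_G[D]$ (closed neighborhood), $P^{i+1}_{G,k}(D)=\bigcup\{N_G[v]: v\in P^i_{G,k}(D),\ |N_G[v]\setminus P^i_{G,k}(D)|\le k\}$; the increasing sequence stabilizes at $P^\infty_{G,k}(D)$. $D$ is a $k$-power dominating set if $P^\infty_{G,k}(D)=V(G)$; $\gamma_{P,k}(G)$ is the minimum size of such a set. *)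

theory Defs
  imports "Graph_Theory.Pair_Digraph"
begin

text \<open>
  A finite simple graph is a \<^locale>\<open>pair_graph\<close>: each undirected edge is represented by both
  of its orientations.
\<close>

section \<open>Sierpinski graphs\<close>

text \<open>
  The vertices of the generation-\<open>g\<close> graph are words of length \<open>g\<close> over \<open>{1,2,3}\<close>.
  The copy of the vertex \<open>v\<close> in the \<open>\<theta>\<close>-th copy of the graph is \<open>\<theta> # v\<close>.

  The recursion for the outmost vertices, \<open>A\<^sub>1 = [1]\<close>, \<open>B\<^sub>1 = [2]\<close>, \<open>C\<^sub>1 = [3]\<close> and
  \<open>A\<^sub>g\<^sub>+\<^sub>1 = 1 # A\<^sub>g\<close>, \<open>B\<^sub>g\<^sub>+\<^sub>1 = 2 # B\<^sub>g\<close>, \<open>C\<^sub>g\<^sub>+\<^sub>1 = 3 # C\<^sub>g\<close>, has the solution below.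
\<close>

definition outA :: "nat \<Rightarrow> nat list" where "outA g = replicate g 1"
definition outB :: "nat \<Rightarrow> nat list" where "outB g = replicate g 2"
definition outC :: "nat \<Rightarrow> nat list" where "outC g = replicate g 3"

text \<open>
  The identifications \<open>B\<^sup>1 ~ A\<^sup>2\<close>, \<open>C\<^sup>2 ~ B\<^sup>3\<close>, \<open>C\<^sup>1 ~ A\<^sup>3\<close>: the map sends each vertex of the
  disjoint union of the three copies to a representative of its class, namely the one in the copy
  with the smaller index.
\<close>

definition glue :: "nat \<Rightarrow> nat list \<Rightarrow> nat list" where
  "glue g v =
     (if v = 2 # outA g then 1 # outB g
      else if v = 3 # outB g then 2 # outC g
      else if v = 3 # outA g then 1 # outC g
      else v)"

text \<open>Generations start at 1; the value at 0 is a dummy.\<close>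

fun sierpinski :: "nat \<Rightarrow> nat list pair_pre_digraph" where
  "sierpinski 0 = \<lparr> pverts = {}, parcs = {} \<rparr>"
| "sierpinski (Suc 0) =
     \<lparr> pverts = {outA 1, outB 1, outC 1},
       parcs = {(u, v). u \<in> {outA 1, outB 1, outC 1} \<and> v \<in> {outA 1, outB 1, outC 1} \<and> u \<noteq> v} \<rparr>"
| "sierpinski (Suc (Suc n)) =
     (let g = Suc n; G = sierpinski g in
     \<lparr> pverts = {glue g (\<theta> # v) | \<theta> v. \<theta> \<in> {1, 2, 3} \<and> v \<in> pverts G},
       parcs = {(glue g (\<theta> # u), glue g (\<theta> # v)) | \<theta> u v. \<theta> \<in> {1, 2, 3} \<and> (u, v) \<in> parcs G} \<rparr>)"

lemma outmost_rec:
  "outA 1 = [1]" "outB 1 = [2]" "outC 1 = [3]"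
  "outA (Suc g) = 1 # outA g" "outB (Suc g) = 2 # outB g" "outC (Suc g) = 3 # outC g"
  by (simp_all add: outA_def outB_def outC_def)

lemma glue_copy_inj: "glue g (\<theta> # u) = glue g (\<theta> # v) \<longleftrightarrow> u = v"
  by (auto simp: glue_def split: if_splits)

lemma glue_eq_iff:
  assumes "g \<ge> 1"
  shows "glue g (\<theta> # u) = glue g (\<eta> # v) \<longleftrightarrow>
    (\<theta> = \<eta> \<and> u = v) \<or>
    (\<exists>(x, y) \<in> {(1 # outB g, 2 # outA g), (2 # outC g, 3 # outB g), (1 # outC g, 3 # outA g)}.
       (\<theta> # u = x \<and> \<eta> # v = y) \<or> (\<theta> # u = y \<and> \<eta> # v = x))"
proof -
  have "outA g \<noteq> outB g" "outA g \<noteq> outC g" "outB g \<noteq> outC g"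
    using assms by (auto simp: outA_def outB_def outC_def)
  then show ?thesis
    by (auto simp: glue_def split: if_splits)
qed

lemma pair_graph_sierpinski: "pair_graph (sierpinski g)"
proof (induction g rule: sierpinski.induct)
  case 1
  show ?case by unfold_locales (auto simp: symmetric_def sym_def)
next
  case 2
  show ?case
  proof unfold_locales
    show "finite (parcs (sierpinski (Suc 0)))"
      by (rule finite_subset[of _ "{outA 1, outB 1, outC 1} \<times> {outA 1, outB 1, outC 1}"]) auto
  qed (auto simp: symmetric_def sym_def)
next
  case (3 n)
  define g where "g = Suc n"
  interpret G: pair_graph "sierpinski g" using 3 g_def by simp
  have V: "pverts (sierpinski (Suc g)) =
      (\<lambda>(\<theta>, v). glue g (\<theta> # v)) ` ({1, 2, 3} \<times> pverts (sierpinski g))"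
    by (auto simp: g_def Let_def)
  have E: "parcs (sierpinski (Suc g)) =
      (\<lambda>(\<theta>, u, v). (glue g (\<theta> # u), glue g (\<theta> # v))) ` ({1, 2, 3} \<times> parcs (sierpinski g))"
    by (force simp: g_def Let_def)
  have sym: "(v, u) \<in> parcs (sierpinski g)" if "(u, v) \<in> parcs (sierpinski g)" for u v
    using G.pair_sym_arcs that by (auto simp: symmetric_def sym_def)
  have irr: "(u, u) \<notin> parcs (sierpinski g)" for u
    using G.pair_no_loops[of "(u, u)"] by auto
  have "pair_graph (sierpinski (Suc g))"
  proof unfold_locales
    show "finite (pverts (sierpinski (Suc g)))" "finite (parcs (sierpinski (Suc g)))"
      unfolding V E using G.pair_finite_verts G.pair_finite_arcs by auto
    show "symmetric (with_proj (sierpinski (Suc g)))"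
      unfolding symmetric_def with_proj_simps
    proof (rule symI)
      fix x y assume "(x, y) \<in> parcs (sierpinski (Suc g))"
      then obtain \<theta> u v where "x = glue g (\<theta> # u)" "y = glue g (\<theta> # v)" "\<theta> \<in> {1, 2, 3}"
        "(u, v) \<in> parcs (sierpinski g)" unfolding E by auto
      with sym show "(y, x) \<in> parcs (sierpinski (Suc g))"
        unfolding E by (intro image_eqI[of _ _ "(\<theta>, v, u)"]) auto
    qed
  next
    fix e assume "e \<in> parcs (sierpinski (Suc g))"
    then obtain \<theta> u v where e: "e = (glue g (\<theta> # u), glue g (\<theta> # v))" "\<theta> \<in> {1, 2, 3}"
      "(u, v) \<in> parcs (sierpinski g)" unfolding E by auto
    then have "u \<noteq> v" "u \<in> pverts (sierpinski g)" "v \<in> pverts (sierpinski g)"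
      using irr G.in_arcsD1 G.in_arcsD2 by auto
    with e show "fst e \<in> pverts (sierpinski (Suc g))" "snd e \<in> pverts (sierpinski (Suc g))"
      "fst e \<noteq> snd e"
      unfolding V by (auto simp: glue_copy_inj)
  qed
  then show ?case by (simp add: g_def)
qed

section \<open>Power domination\<close>

definition closed_nbhd :: "'a pair_pre_digraph \<Rightarrow> 'a \<Rightarrow> 'a set" where
  "closed_nbhd G v = insert v {u. (v, u) \<in> parcs G}"

text \<open>
  The finiteness condition in the second clause is vacuous in finite graphs; it excludes infinite
  sets, whose \<^const>\<open>card\<close> is 0.
\<close>

primrec power_dom_step :: "'a pair_pre_digraph \<Rightarrow> nat \<Rightarrow> 'a set \<Rightarrow> nat \<Rightarrow> 'a set" where
  "power_dom_step G k D 0 = (\<Union>v \<in> D. closed_nbhd G v)"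
| "power_dom_step G k D (Suc i) =
     \<Union> {closed_nbhd G v | v. v \<in> power_dom_step G k D i \<and>
          finite (closed_nbhd G v - power_dom_step G k D i) \<and>
          card (closed_nbhd G v - power_dom_step G k D i) \<le> k}"

text \<open>
  The sequence is increasing and, in a finite graph, eventually constant, so its eventual value is
  its union; see \<open>power_dom_step_mono\<close> and \<open>power_dom_step_stabilizes\<close>.
\<close>

definition power_dom_limit :: "'a pair_pre_digraph \<Rightarrow> nat \<Rightarrow> 'a set \<Rightarrow> 'a set" where
  "power_dom_limit G k D = (\<Union>i. power_dom_step G k D i)"

definition power_dominating :: "'a pair_pre_digraph \<Rightarrow> nat \<Rightarrow> 'a set \<Rightarrow> bool" where
  "power_dominating G k D \<longleftrightarrow> D \<subseteq> pverts G \<and> power_dom_limit G k D = pverts G"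

definition power_dom_number :: "nat \<Rightarrow> 'a pair_pre_digraph \<Rightarrow> nat" where
  "power_dom_number k G = (LEAST n. \<exists>D. power_dominating G k D \<and> finite D \<and> card D = n)"

lemma power_dom_step_Suc: "power_dom_step G k D i \<subseteq> power_dom_step G k D (Suc i)"
proof -
  have "\<forall>x \<in> power_dom_step G k D i. \<exists>v \<in> power_dom_step G k D i. x \<in> closed_nbhd G v \<and>
      finite (closed_nbhd G v - power_dom_step G k D i) \<and>
      card (closed_nbhd G v - power_dom_step G k D i) \<le> k"
  proof (induction i)
    case 0
    show ?case
    proof
      fix x assume "x \<in> power_dom_step G k D 0"
      then obtain v where v: "v \<in> D" "x \<in> closed_nbhd G v" by auto
      then have "v \<in> power_dom_step G k D 0" "closed_nbhd G v - power_dom_step G k D 0 = {}"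
        by (auto simp: closed_nbhd_def)
      with v show "\<exists>v \<in> power_dom_step G k D 0. x \<in> closed_nbhd G v \<and>
        finite (closed_nbhd G v - power_dom_step G k D 0) \<and>
        card (closed_nbhd G v - power_dom_step G k D 0) \<le> k"
        by (metis card.empty finite.emptyI zero_le)
    qed
  next
    case (Suc i)
    show ?case
    proof
      fix x assume "x \<in> power_dom_step G k D (Suc i)"
      then obtain v where v: "v \<in> power_dom_step G k D i" "x \<in> closed_nbhd G v"
        "finite (closed_nbhd G v - power_dom_step G k D i)"
        "card (closed_nbhd G v - power_dom_step G k D i) \<le> k" by auto
      then have "closed_nbhd G v \<subseteq> power_dom_step G k D (Suc i)" by auto
      then have "v \<in> power_dom_step G k D (Suc i)"
        "closed_nbhd G v - power_dom_step G k D (Suc i) = {}"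
        by (auto simp: closed_nbhd_def simp del: power_dom_step.simps)
      with v(2) show "\<exists>v \<in> power_dom_step G k D (Suc i). x \<in> closed_nbhd G v \<and>
        finite (closed_nbhd G v - power_dom_step G k D (Suc i)) \<and>
        card (closed_nbhd G v - power_dom_step G k D (Suc i)) \<le> k"
        by (metis card.empty finite.emptyI zero_le)
    qed
  qed
  then show ?thesis by fastforce
qed

lemma power_dom_step_mono: "i \<le> j \<Longrightarrow> power_dom_step G k D i \<subseteq> power_dom_step G k D j"
  using power_dom_step_Suc by (rule lift_Suc_mono_le)

lemma (in pair_fin_digraph) power_dom_step_subset:
  assumes "D \<subseteq> pverts G"
  shows "power_dom_step G k D i \<subseteq> pverts G"
proof -
  have *: "closed_nbhd G v \<subseteq> pverts G" if "v \<in> pverts G" for v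
    using that in_arcsD2 by (auto simp: closed_nbhd_def)
  show ?thesis
  proof (induction i)
    case 0
    show ?case using assms * by auto
  next
    case (Suc i)
    then show ?case using * by fastforce
  qed
qed

lemma (in pair_fin_digraph) power_dom_step_stabilizes:
  assumes "D \<subseteq> pverts G"
  shows "\<exists>m. \<forall>i \<ge> m. power_dom_step G k D i = power_dom_limit G k D"
proof -
  let ?P = "power_dom_step G k D"
  have "finite (range ?P)"
    by (rule finite_subset[of _ "Pow (pverts G)"])
      (use power_dom_step_subset[OF assms] pair_finite_verts in auto)
  then obtain I where I: "finite I" "range ?P = ?P ` I"
    by (metis finite_subset_image subset_UNIV subset_refl)
  have le: "?P j \<subseteq> ?P (Max I)" for j
  proof -
    obtain i where "i \<in> I" "?P j = ?P i" using I(2) by blast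
    then show ?thesis using power_dom_step_mono[of i "Max I" G k D] I(1) by simp
  qed
  have "?P i = power_dom_limit G k D" if "i \<ge> Max I" for i
    unfolding power_dom_limit_def using le power_dom_step_mono[OF that, of G k D] by blast
  then show ?thesis by blast
qed

end

theory Submission
  imports Defs
begin

text \<open>
  The corner \<open>A\<close> power dominates as soon as \<open>k \<ge> 2\<close>. Inductively, once \<open>A\<close> and its neighbours are
  observed, propagation through the inner vertices of the first copy observes that whole copy.
  Each junction \<open>B\<^sup>1 = A\<^sup>2\<close>, \<open>C\<^sup>1 = A\<^sup>3\<close> then has at most two unobserved neighbours, the two
  neighbours of the corner \<open>A\<close> of the next copy, so it observes them and the induction hypothesis
  applies to that copy as well.
\<close>

section \<open>Neighbourhoods in the glued graph\<close>

lemma outmost_distinct: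
  assumes "g \<ge> 1"
  shows "outA g \<noteq> outB g" "outA g \<noteq> outC g" "outB g \<noteq> outC g"
  using assms by (auto simp: outA_def outB_def outC_def)

lemma pverts_sierpinski_Suc:
  assumes "g \<ge> 1"
  shows "pverts (sierpinski (Suc g)) =
    {glue g (\<theta> # v) | \<theta> v. \<theta> \<in> {1, 2, 3} \<and> v \<in> pverts (sierpinski g)}"
  using assms by (cases g) (simp_all add: Let_def)

lemma parcs_sierpinski_Suc:
  assumes "g \<ge> 1"
  shows "parcs (sierpinski (Suc g)) =
    {(glue g (\<theta> # u), glue g (\<theta> # v)) | \<theta> u v. \<theta> \<in> {1, 2, 3} \<and> (u, v) \<in> parcs (sierpinski g)}"
  using assms by (cases g) (simp_all add: Let_def)

text \<open>A vertex of the glued graph can come from several copies, and each arc at it is the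
  image of an arc at one of its preimages; so its neighbourhood is collected over all
  preimages.\<close>

lemma closed_nbhd_sierpinski_Suc:
  assumes "g \<ge> 1" "\<theta> \<in> {1, 2, 3}"
  shows "closed_nbhd (sierpinski (Suc g)) (glue g (\<theta> # v)) =
    (\<Union>(\<eta>, u) \<in> {(\<eta>, u). \<eta> \<in> {1, 2, 3} \<and> glue g (\<eta> # u) = glue g (\<theta> # v)}.
       (\<lambda>w. glue g (\<eta> # w)) ` closed_nbhd (sierpinski g) u)"
    (is "?L = ?R")
proof
  show "?L \<subseteq> ?R"
  proof
    fix x assume "x \<in> ?L"
    then consider "x = glue g (\<theta> # v)"
      | \<eta> u w where "\<eta> \<in> {1, 2, 3}" "(u, w) \<in> parcs (sierpinski g)"
          "glue g (\<theta> # v) = glue g (\<eta> # u)" "x = glue g (\<eta> # w)"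
      unfolding closed_nbhd_def parcs_sierpinski_Suc[OF assms(1)] by blast
    then show "x \<in> ?R"
    proof cases
      case 1
      with assms(2) show ?thesis
        unfolding closed_nbhd_def by blast
    next
      case 2
      then show ?thesis
        by (intro UN_I[of "(\<eta>, u)"]) (simp_all add: closed_nbhd_def)
    qed
  qed
  show "?R \<subseteq> ?L"
  proof
    fix x assume "x \<in> ?R"
    then obtain p where p: "fst p \<in> {1, 2, 3}" "glue g (fst p # snd p) = glue g (\<theta> # v)"
      "x \<in> (\<lambda>w. glue g (fst p # w)) ` closed_nbhd (sierpinski g) (snd p)"
      unfolding UN_iff case_prod_beta mem_Collect_eq by blast
    obtain w where w: "x = glue g (fst p # w)" "w \<in> closed_nbhd (sierpinski g) (snd p)"
      using p(3) by (rule imageE)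
    from w(2) consider "w = snd p" | "(snd p, w) \<in> parcs (sierpinski g)"
      unfolding closed_nbhd_def by blast
    then show "x \<in> ?L"
    proof cases
      case 1
      with w(1) p(2) show ?thesis
        by (simp add: closed_nbhd_def)
    next
      case 2
      with p(1) have "(glue g (fst p # snd p), x) \<in> parcs (sierpinski (Suc g))"
        unfolding parcs_sierpinski_Suc[OF assms(1)] w(1) by blast
      with p(2) show ?thesis
        by (simp add: closed_nbhd_def)
    qed
  qed
qed

text \<open>Gluing identifies corners only, so an inner vertex has a single preimage and gains no
  neighbours.\<close>

lemma closed_nbhd_inner:
  assumes "g \<ge> 1" "\<theta> \<in> {1, 2, 3}" "v \<notin> {outA g, outB g, outC g}"
  shows "closed_nbhd (sierpinski (Suc g)) (glue g (\<theta> # v)) =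
    (\<lambda>w. glue g (\<theta> # w)) ` closed_nbhd (sierpinski g) v"
proof -
  have "{(\<eta>, u). \<eta> \<in> {1, 2, 3} \<and> glue g (\<eta> # u) = glue g (\<theta> # v)} = {(\<theta>, v)}"
    using assms by (auto simp: glue_eq_iff)
  then show ?thesis
    by (simp add: closed_nbhd_sierpinski_Suc[OF assms(1,2)])
qed

text \<open>Corner \<open>A\<close> of copy 1 takes part in none of the three identifications, so
  its degree does not grow.\<close>

lemma closed_nbhd_outA:
  assumes "g \<ge> 1"
  shows "closed_nbhd (sierpinski (Suc g)) (outA (Suc g)) =
    (\<lambda>w. glue g (1 # w)) ` closed_nbhd (sierpinski g) (outA g)"
proof -
  have "{(\<eta>, u). \<eta> \<in> {1, 2, 3} \<and> glue g (\<eta> # u) = glue g (1 # outA g)} = {(1, outA g)}"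
    using assms outmost_distinct[OF assms] by (auto simp: glue_eq_iff)
  moreover have "outA (Suc g) = glue g (1 # outA g)"
    by (simp add: outmost_rec glue_def)
  ultimately show ?thesis
    by (simp add: closed_nbhd_sierpinski_Suc[OF assms])
qed

text \<open>These are the two junctions at which copy 1 meets corner \<open>A\<close> of another
  copy: \<open>c\<close> is the corner of copy 1 identified with corner \<open>A\<close> of copy
  \<open>\<eta>\<close>. Observation leaves copy 1 through them.\<close>

lemma closed_nbhd_junction:
  assumes "g \<ge> 1" "(\<eta>, c) \<in> {(2, outB g), (3, outC g)}"
  shows "closed_nbhd (sierpinski (Suc g)) (glue g (\<eta> # outA g)) =
    (\<lambda>w. glue g (1 # w)) ` closed_nbhd (sierpinski g) c \<union>
    (\<lambda>w. glue g (\<eta> # w)) ` closed_nbhd (sierpinski g) (outA g)"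
proof -
  have "{(\<zeta>, u). \<zeta> \<in> {1, 2, 3} \<and> glue g (\<zeta> # u) = glue g (\<eta> # outA g)} = {(1, c), (\<eta>, outA g)}"
    using assms outmost_distinct[OF assms(1)] by (auto simp: glue_eq_iff)
  moreover have "\<eta> \<in> {1, 2, 3}"
    using assms(2) by auto
  ultimately show ?thesis
    by (simp add: closed_nbhd_sierpinski_Suc[OF assms(1)])
qed

text \<open>A propagation rule restricted to inner vertices of the glued graph thereby covers the
  inner vertices of every copy.\<close>

lemma glue_inner_not_outmost:
  assumes "v \<notin> {outA g, outB g, outC g}"
  shows "glue g (\<theta> # v) \<notin> {outA (Suc g), outB (Suc g), outC (Suc g)}"
  using assms by (auto simp: glue_def outmost_rec)

text \<open>Junctions become inner vertices of the next generation, so the propagation rule may be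
  used at them.\<close>

lemma junction_not_outmost:
  assumes "g \<ge> 1" "\<eta> \<in> {2, 3}"
  shows "glue g (\<eta> # outA g) \<notin> {outA (Suc g), outB (Suc g), outC (Suc g)}"
  using assms outmost_distinct[OF assms(1)] by (auto simp: glue_def outmost_rec)

lemma finite_closed_nbhd_sierpinski: "finite (closed_nbhd (sierpinski g) v)"
proof -
  interpret pair_graph "sierpinski g" by (rule pair_graph_sierpinski)
  have "closed_nbhd (sierpinski g) v \<subseteq> insert v (snd ` parcs (sierpinski g))"
    by (force simp: closed_nbhd_def)
  then show ?thesis
    by (rule finite_subset) simp
qed

text \<open>The bound counts the corner and its two neighbours in the triangle; each gluing step
  preserves it by \<open>closed_nbhd_outA\<close>.\<close>

lemma card_closed_nbhd_outA:
  assumes "g \<ge> 1"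
  shows "card (closed_nbhd (sierpinski g) (outA g)) \<le> 3"
  using assms
proof (induction g rule: dec_induct)
  case base
  have "closed_nbhd (sierpinski 1) (outA 1) \<subseteq> {outA 1, outB 1, outC 1}"
    by (auto simp: closed_nbhd_def)
  then have "card (closed_nbhd (sierpinski 1) (outA 1)) \<le> card {outA 1, outB 1, outC 1}"
    by (intro card_mono) auto
  also have "\<dots> \<le> 3"
    by (simp add: card_insert_if)
  finally show ?case .
next
  case (step g)
  then show ?case
    using card_image_le[OF finite_closed_nbhd_sierpinski] le_trans
    unfolding closed_nbhd_outA[OF step(1)] by blast
qed

lemma outmost_in_sierpinski:
  assumes "g \<ge> 1"
  shows "{outA g, outB g, outC g} \<subseteq> pverts (sierpinski g)"
  using assms
proof (induction g rule: dec_induct)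
  case (step g)
  have "outA (Suc g) = glue g (1 # outA g)" "outB (Suc g) = glue g (2 # outB g)"
    "outC (Suc g) = glue g (3 # outC g)"
    using outmost_distinct[OF step(1)] by (auto simp: outmost_rec glue_def)
  with step show ?case
    unfolding pverts_sierpinski_Suc[OF step(1)] by blast
qed simp

section \<open>Propagation from the corner A\<close>

text \<open>
  The propagation rule is assumed at inner vertices only: a corner of a copy gains neighbours
  when the copies are glued, so nothing more is inherited by the copies.
\<close>

lemma sierpinski_propagation:
  assumes "g \<ge> 1"
    and "closed_nbhd (sierpinski g) (outA g) \<subseteq> X"
    and "\<And>v. v \<in> X \<Longrightarrow> v \<notin> {outA g, outB g, outC g} \<Longrightarrow>
      card (closed_nbhd (sierpinski g) v - X) \<le> 2 \<Longrightarrow> closed_nbhd (sierpinski g) v \<subseteq> X"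
  shows "pverts (sierpinski g) \<subseteq> X"
  using assms
proof (induction g arbitrary: X rule: dec_induct)
  case base
  \<comment> \<open>In a triangle the closed neighbourhood of a vertex is everything.\<close>
  have "pverts (sierpinski 1) \<subseteq> closed_nbhd (sierpinski 1) (outA 1)"
    by (auto simp: closed_nbhd_def)
  with base show ?case by blast
next
  case (step g)
  let ?N = "closed_nbhd (sierpinski g)" and ?N' = "closed_nbhd (sierpinski (Suc g))"
  have inj: "inj_on (\<lambda>w. glue g (\<theta> # w)) S" for \<theta> S
    by (auto simp: inj_on_def glue_copy_inj)
  have copy: "glue g (\<theta> # w) \<in> X"
    if \<theta>: "\<theta> \<in> {1, 2, 3}" and A: "(\<lambda>w. glue g (\<theta> # w)) ` ?N (outA g) \<subseteq> X"
      and w: "w \<in> pverts (sierpinski g)" for \<theta> w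
  proof -
    let ?f = "\<lambda>w. glue g (\<theta> # w)"
    \<comment> \<open>The induction hypothesis is applied to the preimage of \<open>X\<close> under
      the copy map. This map is injective and carries neighbourhoods of inner vertices onto
      neighbourhoods, so the numbers of unobserved neighbours agree.\<close>
    have "pverts (sierpinski g) \<subseteq> ?f -` X"
    proof (rule step.IH)
      show "?N (outA g) \<subseteq> ?f -` X"
        using A by blast
      fix v
      assume v: "v \<in> ?f -` X" "v \<notin> {outA g, outB g, outC g}" "card (?N v - ?f -` X) \<le> 2"
      have N': "?N' (?f v) = ?f ` ?N v"
        by (rule closed_nbhd_inner[OF step(1) \<theta> v(2)])
      then have "?N' (?f v) - X = ?f ` (?N v - ?f -` X)"
        by auto
      then have "card (?N' (?f v) - X) \<le> 2"
        using v(3) by (simp add: card_image[OF inj])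
      then have "?N' (?f v) \<subseteq> X"
        using step.prems(2) v(1) glue_inner_not_outmost[OF v(2)] by auto
      then show "?N v \<subseteq> ?f -` X"
        unfolding N' by blast
    qed
    with w show ?thesis by blast
  qed
  have copy1: "glue g (1 # w) \<in> X" if "w \<in> pverts (sierpinski g)" for w
    using copy[OF _ _ that, of 1] step.prems(1) closed_nbhd_outA[OF step(1)] by simp
  interpret G: pair_graph "sierpinski g" by (rule pair_graph_sierpinski)
  have next_copy: "(\<lambda>w. glue g (\<eta> # w)) ` ?N (outA g) \<subseteq> X"
    if \<eta>: "(\<eta>, c) \<in> {(2, outB g), (3, outC g)}" for \<eta> c
  proof -
    let ?f = "\<lambda>w. glue g (\<eta> # w)"
    have N': "?N' (?f (outA g)) = (\<lambda>w. glue g (1 # w)) ` ?N c \<union> ?f ` ?N (outA g)"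
      by (rule closed_nbhd_junction[OF step(1) \<eta>])
    have c: "c \<in> pverts (sierpinski g)"
      using \<eta> outmost_in_sierpinski[OF step(1)] by auto
    have "?N c \<subseteq> pverts (sierpinski g)"
      using c G.in_arcsD2 by (auto simp: closed_nbhd_def)
    then have old: "(\<lambda>w. glue g (1 # w)) ` ?N c \<subseteq> X"
      using copy1 by blast
    have "?f (outA g) = glue g (1 # c)"
      using \<eta> step(1) by (auto simp: glue_eq_iff)
    then have A: "?f (outA g) \<in> X"
      using copy1[OF c] by simp
    \<comment> \<open>The junction and its neighbours in copy 1 are already in \<open>X\<close>;
      only neighbours of corner \<open>A\<close> inside copy \<open>\<eta>\<close> can be missing,
      and there are at most two. This is where the threshold 2 comes from.\<close>
    have "?N' (?f (outA g)) - X \<subseteq> ?f ` (?N (outA g) - {outA g})"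
      using N' old A by auto
    then have "card (?N' (?f (outA g)) - X) \<le> card (?N (outA g) - {outA g})"
      using finite_closed_nbhd_sierpinski by (meson surj_card_le finite_Diff)
    also have "\<dots> \<le> 2"
      using card_closed_nbhd_outA[OF step(1)]
      by (subst card_Diff_singleton) (auto simp: closed_nbhd_def)
    finally have "?N' (?f (outA g)) \<subseteq> X"
      using step.prems(2)[OF A] junction_not_outmost[OF step(1), of \<eta>] \<eta> by auto
    then show ?thesis
      unfolding N' by blast
  qed
  have "glue g (\<theta> # w) \<in> X" if "\<theta> \<in> {1, 2, 3}" "w \<in> pverts (sierpinski g)" for \<theta> w
    using that copy1 copy[of 2 w] copy[of 3 w] next_copy by auto
  then show ?case
    unfolding pverts_sierpinski_Suc[OF step(1)] by blast
qed

section \<open>The power domination number\<close>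

text \<open>In a finite graph the limit equals some stage \<open>m\<close>, so a vertex with few
  enough unobserved neighbours adds its neighbourhood at stage \<open>Suc m\<close>, which is again
  the limit.\<close>

lemma (in pair_fin_digraph) power_dom_limit_closed:
  assumes "D \<subseteq> pverts G" "v \<in> power_dom_limit G k D"
    and "card (closed_nbhd G v - power_dom_limit G k D) \<le> k"
  shows "closed_nbhd G v \<subseteq> power_dom_limit G k D"
proof -
  obtain m where m: "power_dom_step G k D i = power_dom_limit G k D" if "i \<ge> m" for i
    using power_dom_step_stabilizes[OF assms(1)] by blast
  have "closed_nbhd G v \<subseteq> insert v (snd ` parcs G)"
    by (force simp: closed_nbhd_def)
  then have "finite (closed_nbhd G v)"
    by (rule finite_subset) simp
  then have "closed_nbhd G v \<subseteq> power_dom_step G k D (Suc m)"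
    using assms m[of m] by auto
  then show ?thesis
    using m[of "Suc m"] by simp
qed

lemma power_dominating_outA:
  assumes "g \<ge> 1" "k \<ge> 2"
  shows "power_dominating (sierpinski g) k {outA g}"
proof -
  interpret pair_graph "sierpinski g" by (rule pair_graph_sierpinski)
  let ?L = "power_dom_limit (sierpinski g) k {outA g}"
  have A: "{outA g} \<subseteq> pverts (sierpinski g)"
    using outmost_in_sierpinski[OF assms(1)] by simp
  \<comment> \<open>Take the limit as the set \<open>X\<close>: it contains the neighbourhood of
    \<open>A\<close> as stage 0, and its closure under the rule for \<open>k\<close> gives the rule
    for 2 because \<open>k \<ge> 2\<close>.\<close>
  have "pverts (sierpinski g) \<subseteq> ?L"
  proof (rule sierpinski_propagation[OF assms(1)])
    have "power_dom_step (sierpinski g) k {outA g} 0 \<subseteq> ?L"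
      unfolding power_dom_limit_def by blast
    then show "closed_nbhd (sierpinski g) (outA g) \<subseteq> ?L"
      by simp
  qed (use power_dom_limit_closed[OF A] assms(2) le_trans in blast)
  moreover have "?L \<subseteq> pverts (sierpinski g)"
    unfolding power_dom_limit_def using power_dom_step_subset[OF A] by blast
  ultimately show ?thesis
    using A by (auto simp: power_dominating_def)
qed

text \<open>Nothing is ever observed from an empty start; this rules out the value 0 for a graph
  with vertices.\<close>

lemma power_dom_limit_empty: "power_dom_limit G k {} = {}"
proof -
  have "power_dom_step G k {} i = {}" for i
    by (induction i) auto
  then show ?thesis
    by (simp add: power_dom_limit_def)
qed

theorem theorem2:
  fixes g k :: nat
  assumes "g \<ge> 1" and "k \<in> {2, 3}"
  shows "power_dom_number k (sierpinski g) = 1"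
  unfolding power_dom_number_def
proof (rule Least_equality)
  have "power_dominating (sierpinski g) k {outA g}"
    using assms by (intro power_dominating_outA) auto
  then show "\<exists>D. power_dominating (sierpinski g) k D \<and> finite D \<and> card D = 1"
    by (intro exI[of _ "{outA g}"]) simp
next
  fix n assume "\<exists>D. power_dominating (sierpinski g) k D \<and> finite D \<and> card D = n"
  then obtain D where D: "power_dominating (sierpinski g) k D" "finite D" "card D = n"
    by blast
  have "D \<noteq> {}"
    using D(1) outmost_in_sierpinski[OF assms(1)]
    by (auto simp: power_dominating_def power_dom_limit_empty)
  with D(2,3) show "1 \<le> n"
    by (auto simp: Suc_le_eq card_gt_0_iff)
qed

end
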